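(* The category $\Delta S_+$, with the product $\odot$, unit object $[-1]$ and transposition $\gamma$ described in the context, is a permutative category (i.e. a strictly associative and strictly unital symmetric monoidal category).
   Context: Category $\Delta S$: objects are the sets $[n]=\{0,1,\dots,n\}$, $n\ge 0$; a morphism $[n]\to[m]$ is a set map $f$ together with a total order on each fibre $f^{-1}(j)$. The composite of $f:[n]\to[m]$ and $g:[m]\to[l]$ has underlying map $g\circ f$, and the fibre over $i$ is ordered by concatenating the ordered fibres $f^{-1}(j)$, with $j$ running over $g^{-1}(i)$ in its given order. $\Delta S_+$ is obtained from $\Delta S$ by adjoining the object $[-1]=\emptyset$ and a unique morphism $\iota_n:[-1]\to[n]$ for each $n\ge -1$ (there are no morphisms $[n]\to[-1]$ for $n\ge 0$). Structure: $[n]\odot[m]=[n+m+1]$ (disjoint union, the points of $[n]$ first, followed by those of $[m]$); for morphisms $\alpha:[n]\to[n']$ and $\beta:[m]\to[m']$, $\alpha\odot\beta:[n+m+1]\to[n'+m'+1]$ acts as $\alpha$ on the first $n+1$ points and as $\beta$ on the remaining $m+1$ points (with the inherited fibre orders). The transposition $\gamma_{n,m}:[n]\odot[m]\to[m]\odot[n]$ is the isomorphism of $[n+m+1]$ given by the block transposition switching the first block of size $n+1$ with the second block of size $m+1$. *)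

theory Defs
  imports Main "HOL-Library.FuncSet"
begin

section \<open>Categories, functors, natural transformations\<close>

record ('o, 'm) precat =
  Ob :: "'o set"
  Mor :: "'m set"
  Dom :: "'m \<Rightarrow> 'o"
  Cod :: "'m \<Rightarrow> 'o"
  Idn :: "'o \<Rightarrow> 'm"
  Comp :: "'m \<Rightarrow> 'm \<Rightarrow> 'm"  \<comment> \<open>\<open>Comp C g f\<close> is \<open>g\<close> after \<open>f\<close>\<close>

definition Hom :: "('o, 'm, 'x) precat_scheme \<Rightarrow> 'o \<Rightarrow> 'o \<Rightarrow> 'm set" where
  "Hom C a b = {f \<in> Mor C. Dom C f = a \<and> Cod C f = b}"

locale category =
  fixes C :: "('o, 'm, 'x) precat_scheme"
  assumes dom_in_Ob: "f \<in> Mor C \<Longrightarrow> Dom C f \<in> Ob C"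
    and cod_in_Ob: "f \<in> Mor C \<Longrightarrow> Cod C f \<in> Ob C"
    and id_in_Hom: "a \<in> Ob C \<Longrightarrow> Idn C a \<in> Hom C a a"
    and comp_in_Hom: "f \<in> Hom C a b \<Longrightarrow> g \<in> Hom C b c \<Longrightarrow> Comp C g f \<in> Hom C a c"
    and comp_id_right: "f \<in> Hom C a b \<Longrightarrow> Comp C f (Idn C a) = f"
    and comp_id_left: "f \<in> Hom C a b \<Longrightarrow> Comp C (Idn C b) f = f"
    and comp_assoc: "f \<in> Hom C a b \<Longrightarrow> g \<in> Hom C b c \<Longrightarrow> h \<in> Hom C c d \<Longrightarrow>
      Comp C h (Comp C g f) = Comp C (Comp C h g) f"

definition product_cat ::
  "('o, 'm) precat \<Rightarrow> ('p, 'n) precat \<Rightarrow> ('o \<times> 'p, 'm \<times> 'n) precat" where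
  "product_cat C D = \<lparr>
     Ob = Ob C \<times> Ob D,
     Mor = Mor C \<times> Mor D,
     Dom = (\<lambda>(f, g). (Dom C f, Dom D g)),
     Cod = (\<lambda>(f, g). (Cod C f, Cod D g)),
     Idn = (\<lambda>(a, b). (Idn C a, Idn D b)),
     Comp = (\<lambda>(f', g') (f, g). (Comp C f' f, Comp D g' g)) \<rparr>"

locale covariant_functor = source: category C + target: category D
  for C :: "('o, 'm) precat" and D :: "('p, 'n) precat" +
  fixes Fo :: "'o \<Rightarrow> 'p" and Fm :: "'m \<Rightarrow> 'n"
  assumes functor_Ob: "a \<in> Ob C \<Longrightarrow> Fo a \<in> Ob D"
    and functor_Hom: "f \<in> Hom C a b \<Longrightarrow> Fm f \<in> Hom D (Fo a) (Fo b)"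
    and functor_id: "a \<in> Ob C \<Longrightarrow> Fm (Idn C a) = Idn D (Fo a)"
    and functor_comp: "f \<in> Hom C a b \<Longrightarrow> g \<in> Hom C b c \<Longrightarrow>
      Fm (Comp C g f) = Comp D (Fm g) (Fm f)"

locale natural_transformation =
  F: covariant_functor C D Fo Fm + G: covariant_functor C D Go Gm
  for C :: "('o, 'm) precat" and D :: "('p, 'n) precat"
    and Fo Fm Go Gm +
  fixes \<tau> :: "'o \<Rightarrow> 'n"
  assumes component_in_Hom: "a \<in> Ob C \<Longrightarrow> \<tau> a \<in> Hom D (Fo a) (Go a)"
    and naturality: "f \<in> Hom C a b \<Longrightarrow> Comp D (\<tau> b) (Fm f) = Comp D (Gm f) (\<tau> a)"


section \<open>Permutative categories\<close>

text \<open>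
  A strictly associative, strictly unital symmetric monoidal category: a bifunctor that is
  associative and unital on the nose, on objects and on morphisms, with a symmetry
  \<open>\<gamma> a b : a \<odot> b \<rightarrow> b \<odot> a\<close>. Since the associativity and unit constraints are identities,
  their naturality is the equality of functors, the pentagon and triangle axioms are trivial,
  and the hexagon axiom becomes a triangle.
\<close>

locale permutative_category = category C
  for C :: "('o, 'm) precat" +
  fixes prod_ob :: "'o \<Rightarrow> 'o \<Rightarrow> 'o"
    and prod_mor :: "'m \<Rightarrow> 'm \<Rightarrow> 'm"
    and unit_ob :: 'o
    and \<gamma> :: "'o \<Rightarrow> 'o \<Rightarrow> 'm"
  assumes prod_functor:
      "covariant_functor (product_cat C C) C
         (\<lambda>(a, b). prod_ob a b) (\<lambda>(f, g). prod_mor f g)"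
    and unit_in_Ob: "unit_ob \<in> Ob C"
    and assoc_Ob: "\<lbrakk>a \<in> Ob C; b \<in> Ob C; c \<in> Ob C\<rbrakk> \<Longrightarrow>
      prod_ob (prod_ob a b) c = prod_ob a (prod_ob b c)"
    and assoc_Mor: "\<lbrakk>f \<in> Mor C; g \<in> Mor C; h \<in> Mor C\<rbrakk> \<Longrightarrow>
      prod_mor (prod_mor f g) h = prod_mor f (prod_mor g h)"
    and unit_left_Ob: "a \<in> Ob C \<Longrightarrow> prod_ob unit_ob a = a"
    and unit_right_Ob: "a \<in> Ob C \<Longrightarrow> prod_ob a unit_ob = a"
    and unit_left_Mor: "f \<in> Mor C \<Longrightarrow> prod_mor (Idn C unit_ob) f = f"
    and unit_right_Mor: "f \<in> Mor C \<Longrightarrow> prod_mor f (Idn C unit_ob) = f"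
    and symmetry_natural:
      "natural_transformation (product_cat C C) C
         (\<lambda>(a, b). prod_ob a b) (\<lambda>(f, g). prod_mor f g)
         (\<lambda>(a, b). prod_ob b a) (\<lambda>(f, g). prod_mor g f)
         (\<lambda>(a, b). \<gamma> a b)"
    and symmetry_involutive: "\<lbrakk>a \<in> Ob C; b \<in> Ob C\<rbrakk> \<Longrightarrow>
      Comp C (\<gamma> b a) (\<gamma> a b) = Idn C (prod_ob a b)"
    and symmetry_unit_right: "a \<in> Ob C \<Longrightarrow> \<gamma> a unit_ob = Idn C a"
    and symmetry_unit_left: "a \<in> Ob C \<Longrightarrow> \<gamma> unit_ob a = Idn C a"
    and symmetry_hexagon: "\<lbrakk>a \<in> Ob C; b \<in> Ob C; c \<in> Ob C\<rbrakk> \<Longrightarrow>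
      \<gamma> (prod_ob a b) c =
      Comp C (prod_mor (\<gamma> a c) (Idn C b)) (prod_mor (Idn C a) (\<gamma> b c))"


section \<open>The category \<open>\<Delta>S\<^sub>+\<close>\<close>

text \<open>
  The object \<open>[n]\<close> is represented by the integer \<open>n \<ge> -1\<close>; its set of points is \<open>{0..n}\<close>,
  which is empty for \<open>n = -1\<close>. To make equality of records coincide with equality of
  morphisms, \<open>umap\<close> is required to be \<open>undefined\<close> outside the source and \<open>fib_ord\<close> to be
  empty outside the target. Orders are reflexive (non-strict) total orders.
\<close>

record ds_mor =
  src :: int
  tgt :: int
  umap :: "int \<Rightarrow> int"
  fib_ord :: "int \<Rightarrow> int rel"

definition fibre :: "ds_mor \<Rightarrow> int \<Rightarrow> int set" where
  "fibre f j = {x \<in> {0..src f}. umap f x = j}"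

definition is_ds_mor :: "ds_mor \<Rightarrow> bool" where
  "is_ds_mor f \<longleftrightarrow> -1 \<le> src f \<and> -1 \<le> tgt f \<and>
     umap f \<in> {0..src f} \<rightarrow>\<^sub>E {0..tgt f} \<and>
     (\<forall>j \<in> {0..tgt f}. linear_order_on (fibre f j) (fib_ord f j)) \<and>
     (\<forall>j. j \<notin> {0..tgt f} \<longrightarrow> fib_ord f j = {})"

text \<open>
  An injective map has fibres with at most one point, hence unique fibre orders.
  Only injective \<open>p\<close> are used below.
\<close>

definition inj_mor :: "int \<Rightarrow> int \<Rightarrow> (int \<Rightarrow> int) \<Rightarrow> ds_mor" where
  "inj_mor n m p = \<lparr> src = n, tgt = m, umap = restrict p {0..n},
     fib_ord = (\<lambda>j. Id_on {x \<in> {0..n}. p x = j}) \<rparr>"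

definition ds_id :: "int \<Rightarrow> ds_mor" where
  "ds_id n = inj_mor n n (\<lambda>x. x)"

text \<open>
  The fibre of \<open>g \<circ> f\<close> over \<open>i\<close> is the concatenation of the fibres \<open>f\<^sup>-\<^sup>1(j)\<close> for \<open>j\<close> running
  through \<open>g\<^sup>-\<^sup>1(i)\<close> in order: points in different blocks are compared by their blocks, points
  in the same block by the order of that block.
\<close>

definition ds_comp :: "ds_mor \<Rightarrow> ds_mor \<Rightarrow> ds_mor" where
  "ds_comp g f = \<lparr> src = src f, tgt = tgt g,
     umap = compose {0..src f} (umap g) (umap f),
     fib_ord = (\<lambda>i. {(x, y). x \<in> {0..src f} \<and> y \<in> {0..src f} \<and>
       umap g (umap f x) = i \<and> umap g (umap f y) = i \<and>
       (if umap f x = umap f y then (x, y) \<in> fib_ord f (umap f x)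
        else (umap f x, umap f y) \<in> fib_ord g i)}) \<rparr>"

definition DeltaS_plus :: "(int, ds_mor) precat" where
  "DeltaS_plus = \<lparr> Ob = {n. -1 \<le> n}, Mor = {f. is_ds_mor f}, Dom = src, Cod = tgt,
     Idn = ds_id, Comp = ds_comp \<rparr>"

text \<open>
  The definition treats \<open>[-1]\<close> uniformly with the other objects; the next two facts confirm that
  this agrees with adjoining \<open>[-1]\<close> and unique morphisms \<open>\<iota>\<^sub>n : [-1] \<rightarrow> [n]\<close> to \<open>\<Delta>S\<close>.
\<close>

lemma DeltaS_plus_unique_from_empty:
  assumes "-1 \<le> n"
  shows "\<exists>!f. f \<in> Hom DeltaS_plus (-1) n"
proof
  let ?i = "\<lparr> src = -1, tgt = n, umap = (\<lambda>_. undefined), fib_ord = (\<lambda>_. {}) \<rparr>"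
  have "fibre ?i j = {}" for j
    by (simp add: fibre_def)
  then show "?i \<in> Hom DeltaS_plus (-1) n"
    using assms by (simp add: Hom_def DeltaS_plus_def is_ds_mor_def)
  fix f assume "f \<in> Hom DeltaS_plus (-1) n"
  then have f: "is_ds_mor f" "src f = -1" "tgt f = n"
    by (auto simp: Hom_def DeltaS_plus_def)
  have "fib_ord f j = {}" for j
  proof (cases "j \<in> {0..n}")
    case True
    then have "linear_order_on {} (fib_ord f j)"
      using f by (auto simp: is_ds_mor_def fibre_def)
    then show ?thesis
      by (auto simp: order_on_defs)
  qed (use f in \<open>auto simp: is_ds_mor_def\<close>)
  moreover have "umap f = (\<lambda>_. undefined)"
    using f by (auto simp: is_ds_mor_def)
  ultimately show "f = ?i"
    using f by (intro ds_mor.equality) auto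
qed

lemma DeltaS_plus_none_to_empty:
  assumes "0 \<le> n"
  shows "Hom DeltaS_plus n (-1) = {}"
  using assms by (auto simp: Hom_def DeltaS_plus_def is_ds_mor_def)


section \<open>The product \<open>\<odot>\<close> and the transposition\<close>

definition ds_prod_ob :: "int \<Rightarrow> int \<Rightarrow> int" where
  "ds_prod_ob n m = n + m + 1"

definition ds_prod_mor :: "ds_mor \<Rightarrow> ds_mor \<Rightarrow> ds_mor" where
  "ds_prod_mor \<alpha> \<beta> = (let n = src \<alpha>; n' = tgt \<alpha>; m = src \<beta>; m' = tgt \<beta> in
     \<lparr> src = ds_prod_ob n m, tgt = ds_prod_ob n' m',
       umap = (\<lambda>x \<in> {0..ds_prod_ob n m}.
         if x \<le> n then umap \<alpha> x else umap \<beta> (x - (n + 1)) + (n' + 1)),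
       fib_ord = (\<lambda>j.
         if j \<le> n' then fib_ord \<alpha> j
         else (\<lambda>(x, y). (x + (n + 1), y + (n + 1))) ` fib_ord \<beta> (j - (n' + 1))) \<rparr>)"

definition ds_gamma :: "int \<Rightarrow> int \<Rightarrow> ds_mor" where
  "ds_gamma n m = inj_mor (ds_prod_ob n m) (ds_prod_ob m n)
     (\<lambda>x. if x \<le> n then x + (m + 1) else x - (n + 1))"

end

theory Submission
  imports Defs
begin

text \<open>
  A morphism of \<open>\<Delta>S\<^sub>+\<close> is a map of points together with orders on its fibres. The orders of
  different fibres never interact, so they can be glued to one partial order on the source:
  \<open>x\<close> is below \<open>y\<close> if both lie in the same fibre and that fibre puts \<open>x\<close> before \<open>y\<close>. This
  relation, \<open>fibre_le\<close>, turns everything into a computation with points. A morphism is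
  determined by its map and this relation (\<open>ds_mor_eqI\<close>), and both structural operations act
  on the relation by short formulas:

  \<^item> for a composite \<open>g \<circ> f\<close> it is the lexicographic combination of the two relations: compare
    by \<open>f\<close> inside a fibre of \<open>f\<close>, and compare the images by \<open>g\<close> otherwise
    (\<open>fibre_le_ds_comp\<close>);
  \<^item> for a product \<open>f \<odot> g\<close> it is the disjoint union of the two relations, the second one shifted
    past the first block (\<open>fibre_le_ds_prod_mor\<close>);
  \<^item> for an injective map it is equality, so an equation between injective maps is an
    equation between maps of points.

  Associativity of composition says that iterated lexicographic orders do not depend on the
  bracketing; \<open>\<odot>\<close> is strictly associative because shifts add up, and strictly unital because
  the empty block shifts by zero.
  Functoriality of \<open>\<odot>\<close> holds because a product map respects the division into two blocks:
  points of the second block land beyond the target of the first factor, so comparing in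
  the composite can be done in each block separately.

  The transpositions are injective. Hence the inverse law, the unit laws and the hexagon are
  identities between block permutations of an interval. Naturality needs more, as it
  involves arbitrary fibre orders; but composing with a bijection merely relabels the points of
  a relation, and the block swap relabels the disjoint union for \<open>f \<odot> g\<close> into the one for
  \<open>g \<odot> f\<close>.
\<close>

section \<open>Morphisms as maps with a relation on points\<close>

definition fibre_le :: "ds_mor \<Rightarrow> int \<Rightarrow> int \<Rightarrow> bool" where
  "fibre_le f x y \<longleftrightarrow> x \<in> {0..src f} \<and> y \<in> {0..src f} \<and> umap f x = umap f y \<and>
     (x, y) \<in> fib_ord f (umap f x)"

lemma fibre_leD:
  assumes "fibre_le f x y"
  shows "0 \<le> x" "x \<le> src f" "0 \<le> y" "y \<le> src f" "umap f x = umap f y"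
  using assms by (auto simp: fibre_le_def)

text \<open>
  The linear orders on the fibres become reflexivity, antisymmetry and transitivity of the glued
  relation, and totality inside each fibre. The condition on \<open>fib_ord\<close> expresses that the
  record contains no pairs outside the fibre in question, so that nothing is lost by gluing.
\<close>

lemma is_ds_mor_iff_fibre_le:
  "is_ds_mor f \<longleftrightarrow> -1 \<le> src f \<and> -1 \<le> tgt f \<and> umap f \<in> {0..src f} \<rightarrow>\<^sub>E {0..tgt f} \<and>
     (\<forall>j. fib_ord f j = {(x, y). fibre_le f x y \<and> umap f x = j}) \<and>
     (\<forall>x\<in>{0..src f}. fibre_le f x x) \<and>
     (\<forall>x y. fibre_le f x y \<longrightarrow> fibre_le f y x \<longrightarrow> x = y) \<and>
     (\<forall>x y z. fibre_le f x y \<longrightarrow> fibre_le f y z \<longrightarrow> fibre_le f x z) \<and>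
     (\<forall>x\<in>{0..src f}. \<forall>y\<in>{0..src f}. umap f x = umap f y \<longrightarrow> fibre_le f x y \<or> fibre_le f y x)"
    (is "?L \<longleftrightarrow> ?R")
proof
  assume L: ?L
  then have map: "umap f x \<in> {0..tgt f}" if "x \<in> {0..src f}" for x
    using that by (auto simp: is_ds_mor_def)
  have sub: "fib_ord f j \<subseteq> fibre f j \<times> fibre f j" for j
    using L by (cases "j \<in> {0..tgt f}") (auto simp: is_ds_mor_def order_on_defs)
  have lin: "linear_order_on (fibre f (umap f x)) (fib_ord f (umap f x))"
    if "x \<in> {0..src f}" for x
    using L map[OF that] by (simp add: is_ds_mor_def)
  have "fib_ord f j = {(x, y). fibre_le f x y \<and> umap f x = j}" for j
    using sub[of j] by (auto simp: fibre_le_def fibre_def)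
  moreover have "fibre_le f x x" if "x \<in> {0..src f}" for x
    using lin[OF that] that by (auto simp: fibre_le_def fibre_def order_on_defs refl_on_def)
  moreover have "x = y" if "fibre_le f x y" "fibre_le f y x" for x y
    using lin[of x] that by (auto simp: fibre_le_def order_on_defs dest: antisymD)
  moreover have "fibre_le f x z" if "fibre_le f x y" "fibre_le f y z" for x y z
    using lin[of x] that by (auto simp: fibre_le_def order_on_defs dest: transD)
  moreover have "fibre_le f x y \<or> fibre_le f y x"
    if "x \<in> {0..src f}" "y \<in> {0..src f}" "umap f x = umap f y" for x y
    using lin[of x] calculation(2)[of x] that
    by (cases "x = y") (auto simp: fibre_le_def fibre_def order_on_defs total_on_def)
  ultimately show ?R
    using L unfolding is_ds_mor_def by blast
next
  assume R: ?R
  then have ord: "fib_ord f j = {(x, y). fibre_le f x y \<and> umap f x = j}" for j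
    by blast
  have "linear_order_on (fibre f j) (fib_ord f j)" for j
    unfolding order_on_defs
  proof (intro conjI)
    show "fib_ord f j \<subseteq> fibre f j \<times> fibre f j"
      unfolding ord by (auto simp: fibre_def dest: fibre_leD)
    show "refl_on (fibre f j) (fib_ord f j)"
      using R unfolding ord by (auto simp: refl_on_def fibre_def)
    show "trans (fib_ord f j)"
      using R unfolding ord by (auto intro!: transI dest: fibre_leD)
    show "antisym (fib_ord f j)"
      using R unfolding ord by (auto intro!: antisymI)
    show "total_on (fibre f j) (fib_ord f j)"
      using R unfolding ord by (auto simp: total_on_def fibre_def)
  qed
  moreover have "fib_ord f j = {}" if "j \<notin> {0..tgt f}" for j
  proof -
    have "umap f x \<in> {0..tgt f}" if "fibre_le f x y" for x y
      using R fibre_leD(1,2)[OF that] by (auto simp: PiE_iff)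
    then show ?thesis
      using that unfolding ord by auto
  qed
  ultimately show ?L
    using R unfolding is_ds_mor_def by blast
qed

lemma fib_ord_eq_fibre_leI:
  assumes "\<And>x y. (x, y) \<in> fib_ord f j \<Longrightarrow>
    x \<in> {0..src f} \<and> y \<in> {0..src f} \<and> umap f x = j \<and> umap f y = j"
  shows "fib_ord f j = {(x, y). fibre_le f x y \<and> umap f x = j}"
  using assms by (auto simp: fibre_le_def)

text \<open>
  The principle by which all equations between morphisms with non-trivial fibre orders are
  proved. Values of the map and the relation outside the source are pinned down by
  \<open>is_ds_mor\<close>, so comparing points of the source suffices.
\<close>

lemma ds_mor_eqI:
  assumes "is_ds_mor f" "is_ds_mor g" "src f = src g" "tgt f = tgt g"
    and umap: "\<And>x. 0 \<le> x \<Longrightarrow> x \<le> src g \<Longrightarrow> umap f x = umap g x"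
    and le: "\<And>x y. \<lbrakk>0 \<le> x; x \<le> src g; 0 \<le> y; y \<le> src g\<rbrakk> \<Longrightarrow> fibre_le f x y \<longleftrightarrow> fibre_le g x y"
  shows "f = g"
proof -
  have f: "umap f \<in> {0..src g} \<rightarrow>\<^sub>E {0..tgt g}" "\<And>j. fib_ord f j = {(x, y). fibre_le f x y \<and> umap f x = j}"
    and g: "umap g \<in> {0..src g} \<rightarrow>\<^sub>E {0..tgt g}" "\<And>j. fib_ord g j = {(x, y). fibre_le g x y \<and> umap g x = j}"
    using assms(1-4) unfolding is_ds_mor_iff_fibre_le by simp_all
  have "umap f = umap g"
    using f(1) g(1) umap by (intro PiE_ext) auto
  moreover have "fibre_le f x y \<longleftrightarrow> fibre_le g x y" for x y
  proof (cases "x \<in> {0..src g} \<and> y \<in> {0..src g}")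
    case True
    then show ?thesis
      using le by auto
  next
    case False
    then show ?thesis
      using assms(3) by (auto simp: fibre_le_def)
  qed
  ultimately show ?thesis
    using f(2) g(2) assms(3,4) by (intro ds_mor.equality ext) auto
qed

lemma umap_bounds:
  assumes "is_ds_mor f" "0 \<le> x" "x \<le> src f"
  shows "0 \<le> umap f x" "umap f x \<le> tgt f"
  using assms by (auto simp: is_ds_mor_def PiE_def Pi_def)

lemma is_ds_mor_ge:
  assumes "is_ds_mor f"
  shows "-1 \<le> src f" "-1 \<le> tgt f"
  using assms by (auto simp: is_ds_mor_def)

lemma fibre_le_facts:
  assumes "is_ds_mor f"
  shows fib_ord_eq: "fib_ord f j = {(x, y). fibre_le f x y \<and> umap f x = j}"
    and fibre_le_refl: "0 \<le> x \<Longrightarrow> x \<le> src f \<Longrightarrow> fibre_le f x x"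
    and fibre_le_antisym: "fibre_le f x y \<Longrightarrow> fibre_le f y x \<Longrightarrow> x = y"
    and fibre_le_trans: "fibre_le f x y \<Longrightarrow> fibre_le f y z \<Longrightarrow> fibre_le f x z"
    and fibre_le_total: "\<lbrakk>0 \<le> x; x \<le> src f; 0 \<le> y; y \<le> src f; umap f x = umap f y\<rbrakk> \<Longrightarrow>
      fibre_le f x y \<or> fibre_le f y x"
proof -
  note facts = assms[unfolded is_ds_mor_iff_fibre_le]
  show "fib_ord f j = {(x, y). fibre_le f x y \<and> umap f x = j}"
    using facts by blast
  show "0 \<le> x \<Longrightarrow> x \<le> src f \<Longrightarrow> fibre_le f x x"
    using facts by simp
  show "fibre_le f x y \<Longrightarrow> fibre_le f y x \<Longrightarrow> x = y"
    using facts by blast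
  show "fibre_le f x y \<Longrightarrow> fibre_le f y z \<Longrightarrow> fibre_le f x z"
    using facts by blast
  show "\<lbrakk>0 \<le> x; x \<le> src f; 0 \<le> y; y \<le> src f; umap f x = umap f y\<rbrakk> \<Longrightarrow>
      fibre_le f x y \<or> fibre_le f y x"
    using facts by simp
qed


section \<open>Composition\<close>

lemma src_tgt_ds_comp [simp]: "src (ds_comp g f) = src f" "tgt (ds_comp g f) = tgt g"
  by (simp_all add: ds_comp_def)

lemma umap_ds_comp [simp]:
  "0 \<le> x \<Longrightarrow> x \<le> src f \<Longrightarrow> umap (ds_comp g f) x = umap g (umap f x)"
  by (simp add: ds_comp_def compose_def)

text \<open>
  Concatenating the fibres of \<open>f\<close> along the order of a fibre of \<open>g\<close> is a lexicographic order.
  In the first disjunct \<open>fibre_le f\<close> already implies \<open>umap f x = umap f y\<close>, so the two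
  cases are exclusive.
\<close>

lemma fibre_le_ds_comp:
  assumes "is_ds_mor f" "tgt f = src g"
  shows "fibre_le (ds_comp g f) x y \<longleftrightarrow> fibre_le f x y \<or>
    x \<in> {0..src f} \<and> y \<in> {0..src f} \<and> umap f x \<noteq> umap f y \<and> fibre_le g (umap f x) (umap f y)"
  using assms umap_bounds[OF assms(1)] unfolding fibre_le_def
  by (auto simp: ds_comp_def compose_def)

text \<open>
  A lexicographic combination of orders is an order. The points to watch are transitivity and
  antisymmetry when the images under \<open>f\<close> change: going forth and back between two fibres of \<open>f\<close>
  is excluded by antisymmetry of \<open>fibre_le g\<close>.
\<close>

lemma is_ds_mor_ds_comp:
  assumes f: "is_ds_mor f" and g: "is_ds_mor g" and fg: "tgt f = src g"
  shows "is_ds_mor (ds_comp g f)"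
  unfolding is_ds_mor_iff_fibre_le
proof (intro conjI ballI allI impI)
  note le = fibre_le_ds_comp[OF f fg]
  note bounds = umap_bounds[OF f] umap_bounds[OF g]
  show "- 1 \<le> src (ds_comp g f)" "- 1 \<le> tgt (ds_comp g f)"
    using f g by (simp_all add: is_ds_mor_def)
  show "umap (ds_comp g f) \<in> {0..src (ds_comp g f)} \<rightarrow>\<^sub>E {0..tgt (ds_comp g f)}"
    using bounds fg by (auto simp: ds_comp_def compose_def)
  show "fib_ord (ds_comp g f) j =
    {(x, y). fibre_le (ds_comp g f) x y \<and> umap (ds_comp g f) x = j}" for j
    by (rule fib_ord_eq_fibre_leI) (auto simp: ds_comp_def compose_def)
  show "fibre_le (ds_comp g f) x x" if "x \<in> {0..src (ds_comp g f)}" for x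
    using that by (simp add: le fibre_le_refl[OF f])
  show "x = y" if "fibre_le (ds_comp g f) x y" "fibre_le (ds_comp g f) y x" for x y
    using that fibre_leD(5)[of f x y] fibre_leD(5)[of f y x] fibre_le_antisym[OF f, of x y]
      fibre_le_antisym[OF g, of "umap f x" "umap f y"]
    unfolding le by auto
  show "fibre_le (ds_comp g f) x z"
    if "fibre_le (ds_comp g f) x y" "fibre_le (ds_comp g f) y z" for x y z
  proof (cases "umap f x = umap f y \<or> umap f y = umap f z")
    case True
    then show ?thesis
      using that fibre_leD[of f x y] fibre_leD[of f y z] fibre_le_trans[OF f, of x y z]
      unfolding le by auto
  next
    case False
    then have "fibre_le g (umap f x) (umap f y)" "fibre_le g (umap f y) (umap f z)"
      and "x \<in> {0..src f}" "z \<in> {0..src f}"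
      using that fibre_leD(5)[of f x y] fibre_leD(5)[of f y z] unfolding le by blast+
    then show ?thesis
      using False fibre_le_antisym[OF g, of "umap f x" "umap f y"]
        fibre_le_trans[OF g, of "umap f x" "umap f y" "umap f z"]
      unfolding le by auto
  qed
  show "fibre_le (ds_comp g f) x y \<or> fibre_le (ds_comp g f) y x"
    if "x \<in> {0..src (ds_comp g f)}" "y \<in> {0..src (ds_comp g f)}"
      "umap (ds_comp g f) x = umap (ds_comp g f) y" for x y
    using that fibre_le_total[OF f, of x y] fibre_le_total[OF g, of "umap f x" "umap f y"]
      bounds fg unfolding le by auto
qed

text \<open>
  Both bracketings compare two points at the first stage (\<open>f\<close>, then \<open>g\<close>, then \<open>h\<close>) at which
  their images become equal.
\<close>

lemma ds_comp_assoc: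
  assumes "is_ds_mor f" "is_ds_mor g" "is_ds_mor h" "tgt f = src g" "tgt g = src h"
  shows "ds_comp h (ds_comp g f) = ds_comp (ds_comp h g) f"
proof (rule ds_mor_eqI)
  fix x y
  assume "0 \<le> x" "x \<le> src (ds_comp (ds_comp h g) f)" "0 \<le> y" "y \<le> src (ds_comp (ds_comp h g) f)"
  then show "fibre_le (ds_comp h (ds_comp g f)) x y \<longleftrightarrow> fibre_le (ds_comp (ds_comp h g) f) x y"
    using assms umap_bounds[of f] fibre_leD(5)[of f x y] fibre_leD(5)[of g "umap f x" "umap f y"]
    by (auto simp: fibre_le_ds_comp is_ds_mor_ds_comp)
qed (use assms umap_bounds[of f] in \<open>auto simp: is_ds_mor_ds_comp\<close>)


section \<open>Injective maps\<close>

lemma src_tgt_inj_mor [simp]: "src (inj_mor n m p) = n" "tgt (inj_mor n m p) = m"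
  by (simp_all add: inj_mor_def)

lemma umap_inj_mor [simp]: "0 \<le> x \<Longrightarrow> x \<le> n \<Longrightarrow> umap (inj_mor n m p) x = p x"
  by (simp add: inj_mor_def)

lemma fibre_le_inj_mor [simp]: "fibre_le (inj_mor n m p) x y \<longleftrightarrow> x = y \<and> 0 \<le> x \<and> x \<le> n"
  by (auto simp: fibre_le_def inj_mor_def)

lemma is_ds_mor_inj_mor:
  assumes "-1 \<le> n" "-1 \<le> m" "p \<in> {0..n} \<rightarrow> {0..m}" "inj_on p {0..n}"
  shows "is_ds_mor (inj_mor n m p)"
  using assms unfolding is_ds_mor_iff_fibre_le
  by (auto simp: inj_mor_def fibre_le_def dest: inj_onD)

lemma inj_mor_cong:
  assumes "n = n'" "m = m'" "\<And>x. 0 \<le> x \<Longrightarrow> x \<le> n \<Longrightarrow> p x = q x"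
  shows "inj_mor n m p = inj_mor n' m' q"
  using assms by (auto simp: inj_mor_def fun_eq_iff Id_on_def)

text \<open>
  The fibre orders on both sides are diagonal: comparing images under \<open>p\<close> by equality is comparing
  points by equality, as \<open>p\<close> is injective.
\<close>

lemma ds_comp_inj_mor_inj_mor:
  assumes "p \<in> {0..n} \<rightarrow> {0..m}" "inj_on p {0..n}"
  shows "ds_comp (inj_mor m k q) (inj_mor n m p) = inj_mor n k (q \<circ> p)"
proof (rule ds_mor.equality)
  let ?c = "ds_comp (inj_mor m k q) (inj_mor n m p)"
  have p: "0 \<le> p x \<and> p x \<le> m" if "0 \<le> x" "x \<le> n" for x
    using assms(1) that by auto
  show "umap ?c = umap (inj_mor n k (q \<circ> p))"
    using p by (auto simp: ds_comp_def inj_mor_def compose_def fun_eq_iff)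
  have "(x, y) \<in> fib_ord ?c i \<longleftrightarrow> (x, y) \<in> fib_ord (inj_mor n k (q \<circ> p)) i" for x y i
  proof (cases "x \<in> {0..n} \<and> y \<in> {0..n}")
    case True
    then have "p x = p y \<longleftrightarrow> x = y"
      using assms(2) by (simp add: inj_on_eq_iff)
    with True p[of x] p[of y] show ?thesis
      by (cases "x = y") (simp_all add: ds_comp_def inj_mor_def Id_on_iff)
  next
    case False
    then show ?thesis
      by (auto simp: ds_comp_def inj_mor_def)
  qed
  then show "fib_ord ?c = fib_ord (inj_mor n k (q \<circ> p))"
    by (intro ext) auto
qed simp_all

lemma src_tgt_ds_id [simp]: "src (ds_id n) = n" "tgt (ds_id n) = n"
  by (simp_all add: ds_id_def)

lemma umap_ds_id [simp]: "0 \<le> x \<Longrightarrow> x \<le> n \<Longrightarrow> umap (ds_id n) x = x"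
  by (simp add: ds_id_def)

lemma fibre_le_ds_id [simp]: "fibre_le (ds_id n) x y \<longleftrightarrow> x = y \<and> 0 \<le> x \<and> x \<le> n"
  by (simp add: ds_id_def)

lemma is_ds_mor_ds_id: "-1 \<le> n \<Longrightarrow> is_ds_mor (ds_id n)"
  unfolding ds_id_def by (rule is_ds_mor_inj_mor) auto

lemma ds_comp_id_right:
  assumes "is_ds_mor f"
  shows "ds_comp f (ds_id (src f)) = f"
  using assms
  by (intro ds_mor_eqI)
    (auto simp: is_ds_mor_ds_comp is_ds_mor_ds_id fibre_le_ds_comp fibre_le_refl is_ds_mor_ge)

lemma ds_comp_id_left:
  assumes "is_ds_mor f"
  shows "ds_comp (ds_id (tgt f)) f = f"
  using assms umap_bounds[OF assms]
  by (intro ds_mor_eqI)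
    (auto simp: is_ds_mor_ds_comp is_ds_mor_ds_id fibre_le_ds_comp is_ds_mor_ge)

lemma category_DeltaS_plus: "category DeltaS_plus"
  by unfold_locales
    (auto simp: DeltaS_plus_def Hom_def is_ds_mor_ds_comp is_ds_mor_ds_id
      ds_comp_id_left ds_comp_id_right ds_comp_assoc is_ds_mor_ge)


section \<open>The product\<close>

lemma src_tgt_ds_prod_mor [simp]:
  "src (ds_prod_mor f g) = src f + src g + 1" "tgt (ds_prod_mor f g) = tgt f + tgt g + 1"
  by (simp_all add: ds_prod_mor_def ds_prod_ob_def Let_def)

lemma umap_ds_prod_mor:
  "0 \<le> x \<Longrightarrow> x \<le> src f + src g + 1 \<Longrightarrow> umap (ds_prod_mor f g) x =
    (if x \<le> src f then umap f x else umap g (x - (src f + 1)) + (tgt f + 1))"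
  by (simp add: ds_prod_mor_def ds_prod_ob_def Let_def)

lemma fib_ord_ds_prod_mor:
  "fib_ord (ds_prod_mor f g) j = (if j \<le> tgt f then fib_ord f j
     else (\<lambda>(x, y). (x + (src f + 1), y + (src f + 1))) ` fib_ord g (j - (tgt f + 1)))"
  by (simp add: ds_prod_mor_def Let_def)

text \<open>
  The last claim is what keeps the factors of a product apart: fibres of points in the first
  block of the target lie in the first block of the source, and likewise for the second.
\<close>

lemma umap_ds_prod_mor_bounds:
  assumes f: "is_ds_mor f" and g: "is_ds_mor g" and x: "0 \<le> x" "x \<le> src f + src g + 1"
  shows "0 \<le> umap (ds_prod_mor f g) x" "umap (ds_prod_mor f g) x \<le> tgt f + tgt g + 1"
    "umap (ds_prod_mor f g) x \<le> tgt f \<longleftrightarrow> x \<le> src f"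
proof -
  have "-1 \<le> tgt f" "-1 \<le> tgt g"
    using f g by (auto simp: is_ds_mor_def)
  then show "0 \<le> umap (ds_prod_mor f g) x" "umap (ds_prod_mor f g) x \<le> tgt f + tgt g + 1"
    "umap (ds_prod_mor f g) x \<le> tgt f \<longleftrightarrow> x \<le> src f"
    using x umap_bounds[OF f, of x] umap_bounds[OF g, of "x - (src f + 1)"]
    by (auto simp: umap_ds_prod_mor)
qed

lemma mem_shifted_rel_iff:
  "(x, y) \<in> (\<lambda>(x, y). (x + c, y + c)) ` R \<longleftrightarrow> (x - c, y - c) \<in> R" for c :: int
  by force

text \<open>
  The disjunction describes a disjoint union: \<open>fibre_le\<close> includes that its arguments lie in
  the source, so each disjunct forces both points into its own block.
\<close>

lemma fibre_le_ds_prod_mor: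
  assumes f: "is_ds_mor f" and g: "is_ds_mor g"
  shows "fibre_le (ds_prod_mor f g) x y \<longleftrightarrow>
    fibre_le f x y \<or> fibre_le g (x - (src f + 1)) (y - (src f + 1))"
proof -
  have ge: "-1 \<le> src f" "-1 \<le> src g"
    using f g by (auto simp: is_ds_mor_def)
  show ?thesis
  proof (cases "x \<in> {0..src f + src g + 1} \<and> y \<in> {0..src f + src g + 1}")
    case True
    then have x: "0 \<le> x" "x \<le> src f + src g + 1" and y: "0 \<le> y" "y \<le> src f + src g + 1"
      by auto
    note bx = umap_ds_prod_mor_bounds[OF f g x] and by_ = umap_ds_prod_mor_bounds[OF f g y]
    show ?thesis
      using x y bx(3) by_(3) unfolding fibre_le_def fib_ord_ds_prod_mor
      by (auto simp: mem_shifted_rel_iff umap_ds_prod_mor split: if_splits)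
  next
    case False
    then show ?thesis
      using ge by (auto simp: fibre_le_def)
  qed
qed

text \<open>
  The block of one of the two points decides which disjunct applies; the other point may be
  anywhere, since across blocks both sides are false.
\<close>

lemma fibre_le_ds_prod_mor_left:
  assumes "is_ds_mor f" "is_ds_mor g" "x \<le> src f"
  shows "fibre_le (ds_prod_mor f g) x y \<longleftrightarrow> fibre_le f x y"
  using assms by (auto simp: fibre_le_ds_prod_mor dest: fibre_leD)

lemma fibre_le_ds_prod_mor_right:
  assumes "is_ds_mor f" "is_ds_mor g" "src f < x"
  shows "fibre_le (ds_prod_mor f g) x y \<longleftrightarrow> fibre_le g (x - (src f + 1)) (y - (src f + 1))"
  using assms by (auto simp: fibre_le_ds_prod_mor dest: fibre_leD)

text \<open>
  The order axioms hold in each block separately. For totality it matters that points with equal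
  image lie in the same block.
\<close>

lemma is_ds_mor_ds_prod_mor:
  assumes f: "is_ds_mor f" and g: "is_ds_mor g"
  shows "is_ds_mor (ds_prod_mor f g)"
  unfolding is_ds_mor_iff_fibre_le
proof (intro conjI ballI allI impI)
  let ?h = "ds_prod_mor f g"
  note le = fibre_le_ds_prod_mor[OF f g]
  show "- 1 \<le> src ?h" "- 1 \<le> tgt ?h"
    using f g by (auto simp: is_ds_mor_def)
  show "umap ?h \<in> {0..src ?h} \<rightarrow>\<^sub>E {0..tgt ?h}"
  proof (rule PiE_I)
    show "umap ?h x = undefined" if "x \<notin> {0..src ?h}" for x
      using that by (auto simp: ds_prod_mor_def ds_prod_ob_def Let_def)
  qed (use umap_ds_prod_mor_bounds[OF f g] in auto)
  show "fib_ord ?h j = {(x, y). fibre_le ?h x y \<and> umap ?h x = j}" for j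
  proof -
    have ge: "-1 \<le> src f" "-1 \<le> src g"
      using f g by (auto simp: is_ds_mor_def)
    show ?thesis
    proof (rule fib_ord_eq_fibre_leI)
      fix x y assume xy: "(x, y) \<in> fib_ord ?h j"
      show "x \<in> {0..src ?h} \<and> y \<in> {0..src ?h} \<and> umap ?h x = j \<and> umap ?h y = j"
      proof (cases "j \<le> tgt f")
        case True
        then have "fibre_le f x y" "umap f x = j"
          using xy by (simp_all add: fib_ord_ds_prod_mor fib_ord_eq[OF f])
        then show ?thesis
          using ge fibre_leD[of f x y] by (simp add: umap_ds_prod_mor)
      next
        case False
        let ?x = "x - (src f + 1)" and ?y = "y - (src f + 1)"
        have "fibre_le g ?x ?y" "umap g ?x = j - (tgt f + 1)"
          using xy False
          by (simp_all add: fib_ord_ds_prod_mor fib_ord_eq[OF g] mem_shifted_rel_iff)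
        then show ?thesis
          using ge fibre_leD[of g ?x ?y] by (simp add: umap_ds_prod_mor)
      qed
    qed
  qed
  show "fibre_le ?h x x" if "x \<in> {0..src ?h}" for x
    using that fibre_le_refl[OF f, of x] fibre_le_refl[OF g, of "x - (src f + 1)"]
    unfolding le by (cases "x \<le> src f") simp_all
  note left = fibre_le_ds_prod_mor_left[OF f g] and right = fibre_le_ds_prod_mor_right[OF f g]
  show "x = y" if "fibre_le ?h x y" "fibre_le ?h y x" for x y
  proof (cases "x \<le> src f")
    case True
    then have xy: "fibre_le f x y"
      using that(1) by (simp add: left)
    then have "fibre_le f y x"
      using that(2) fibre_leD(4)[OF xy] by (simp add: left)
    with xy show ?thesis
      by (rule fibre_le_antisym[OF f])
  next
    case False
    then have xy: "fibre_le g (x - (src f + 1)) (y - (src f + 1))"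
      using that(1) by (simp add: right)
    then have "fibre_le g (y - (src f + 1)) (x - (src f + 1))"
      using that(2) fibre_leD(3)[OF xy] by (simp add: right)
    with xy have "x - (src f + 1) = y - (src f + 1)"
      by (rule fibre_le_antisym[OF g])
    then show ?thesis
      by simp
  qed
  show "fibre_le ?h x z" if "fibre_le ?h x y" "fibre_le ?h y z" for x y z
  proof (cases "x \<le> src f")
    case True
    then have xy: "fibre_le f x y"
      using that(1) by (simp add: left)
    then have "fibre_le f y z"
      using that(2) fibre_leD(4)[OF xy] by (simp add: left)
    with xy have "fibre_le f x z"
      by (rule fibre_le_trans[OF f])
    with True show ?thesis
      by (simp add: left)
  next
    case False
    then have xy: "fibre_le g (x - (src f + 1)) (y - (src f + 1))"
      using that(1) by (simp add: right)
    then have "fibre_le g (y - (src f + 1)) (z - (src f + 1))"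
      using that(2) fibre_leD(3)[OF xy] by (simp add: right)
    with xy have "fibre_le g (x - (src f + 1)) (z - (src f + 1))"
      by (rule fibre_le_trans[OF g])
    with False show ?thesis
      by (simp add: right)
  qed
  show "fibre_le ?h x y \<or> fibre_le ?h y x"
    if "x \<in> {0..src ?h}" "y \<in> {0..src ?h}" "umap ?h x = umap ?h y" for x y
    using that umap_ds_prod_mor_bounds(3)[OF f g, of x] umap_ds_prod_mor_bounds(3)[OF f g, of y]
      fibre_le_total[OF f, of x y]
      fibre_le_total[OF g, of "x - (src f + 1)" "y - (src f + 1)"]
    unfolding le by (auto simp: umap_ds_prod_mor)
qed

text \<open>
  The interchange law. If \<open>x\<close> and \<open>y\<close> lie in the same block, both sides are the lexicographic order
  of the factor belonging to that block. If they lie in different blocks, so do their images, and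
  neither side relates them.
\<close>

lemma ds_prod_mor_comp:
  assumes f: "is_ds_mor f" "is_ds_mor f'" "tgt f = src f'"
    and g: "is_ds_mor g" "is_ds_mor g'" "tgt g = src g'"
  shows "ds_prod_mor (ds_comp f' f) (ds_comp g' g) = ds_comp (ds_prod_mor f' g') (ds_prod_mor f g)"
    (is "?l = ?r")
proof (rule ds_mor_eqI)
  have F: "is_ds_mor (ds_comp f' f)" and G: "is_ds_mor (ds_comp g' g)"
    using f g by (simp_all add: is_ds_mor_ds_comp)
  have P: "is_ds_mor (ds_prod_mor f g)" and P': "is_ds_mor (ds_prod_mor f' g')"
    using f g by (simp_all add: is_ds_mor_ds_prod_mor)
  show "is_ds_mor ?l" "is_ds_mor ?r"
    using F G P P' f g by (simp_all add: is_ds_mor_ds_prod_mor is_ds_mor_ds_comp)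
  show "src ?l = src ?r" "tgt ?l = tgt ?r"
    by simp_all
  fix x assume x: "0 \<le> x" "x \<le> src ?r"
  note bx = umap_ds_prod_mor_bounds[OF f(1) g(1), of x]
  show "umap ?l x = umap ?r x"
    using x bx f(3) g(3) by (auto simp: umap_ds_prod_mor)
  fix y assume y: "0 \<le> y" "y \<le> src ?r"
  note by_ = umap_ds_prod_mor_bounds[OF f(1) g(1), of y]
  have tgts: "tgt (ds_prod_mor f g) = src (ds_prod_mor f' g')"
    using f(3) g(3) by simp
  show "fibre_le ?l x y \<longleftrightarrow> fibre_le ?r x y"
  proof (cases "x \<le> src f")
    case True
    then have ux: "umap (ds_prod_mor f g) x = umap f x" "umap f x \<le> src f'"
      using x umap_bounds[OF f(1), of x] f(3) by (simp_all add: umap_ds_prod_mor)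
    \<comment> \<open>The image of \<open>y\<close> stays in terms of the product map, because \<open>y\<close> may be in either block.\<close>
    have "fibre_le ?r x y \<longleftrightarrow> fibre_le f x y \<or> umap f x \<noteq> umap (ds_prod_mor f g) y \<and>
        fibre_le f' (umap f x) (umap (ds_prod_mor f g) y)"
      using True x y ux f g
      by (simp add: fibre_le_ds_comp[OF P tgts] fibre_le_ds_prod_mor_left)
    also have "\<dots> \<longleftrightarrow> fibre_le (ds_comp f' f) x y"
    proof (cases "y \<le> src f")
      case le: True
      then have "umap (ds_prod_mor f g) y = umap f y"
        using y by (simp add: umap_ds_prod_mor)
      then show ?thesis
        using True le x y by (simp add: fibre_le_ds_comp[OF f(1,3)])
    next
      case False
      then have "\<not> fibre_le f' (umap f x) (umap (ds_prod_mor f g) y)"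
        using by_(3) y f(3) by (auto dest: fibre_leD)
      with False show ?thesis
        by (auto simp: fibre_le_ds_comp[OF f(1,3)])
    qed
    finally show ?thesis
      using True F G by (simp add: fibre_le_ds_prod_mor_left)
  next
    case False
    let ?x = "x - (src f + 1)" and ?y = "y - (src f + 1)"
    have ux: "umap (ds_prod_mor f g) x = umap g ?x + (src f' + 1)" "0 \<le> umap g ?x"
      using False x umap_bounds[OF g(1), of ?x] f(3) by (simp_all add: umap_ds_prod_mor)
    let ?v = "umap (ds_prod_mor f g) y - (src f' + 1)"
    have "fibre_le ?r x y \<longleftrightarrow> fibre_le g ?x ?y \<or> umap g ?x \<noteq> ?v \<and> fibre_le g' (umap g ?x) ?v"
      using False x y ux f g
      by (auto simp: fibre_le_ds_comp[OF P tgts] fibre_le_ds_prod_mor_right)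
    also have "\<dots> \<longleftrightarrow> fibre_le (ds_comp g' g) ?x ?y"
    proof (cases "y \<le> src f")
      case True
      then have "\<not> fibre_le g' (umap g ?x) ?v"
        using by_(3) y f(3) by (auto dest: fibre_leD)
      with True show ?thesis
        by (auto simp: fibre_le_ds_comp[OF g(1,3)])
    next
      case gt: False
      then have "?v = umap g ?y"
        using y f(3) by (simp add: umap_ds_prod_mor)
      then show ?thesis
        using False gt x y by (simp add: fibre_le_ds_comp[OF g(1,3)])
    qed
    finally show ?thesis
      using False F G by (simp add: fibre_le_ds_prod_mor_right)
  qed
qed

text \<open>
  Both sides are the disjoint union of three relations; the shift of the last one is
  \<open>(src f + 1) + (src g + 1)\<close> in either bracketing.
\<close>

lemma ds_prod_mor_assoc:
  assumes "is_ds_mor f" "is_ds_mor g" "is_ds_mor h"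
  shows "ds_prod_mor (ds_prod_mor f g) h = ds_prod_mor f (ds_prod_mor g h)"
    (is "?l = ?r")
proof (rule ds_mor_eqI)
  have ge: "-1 \<le> src f" "-1 \<le> src g" "-1 \<le> src h"
    using assms by (auto simp: is_ds_mor_def)
  fix x assume x: "0 \<le> x" "x \<le> src ?r"
  then show "umap ?l x = umap ?r x"
    using ge by (auto simp: umap_ds_prod_mor algebra_simps)
  fix y assume y: "0 \<le> y" "y \<le> src ?r"
  show "fibre_le ?l x y \<longleftrightarrow> fibre_le ?r x y"
    using assms by (auto simp: fibre_le_ds_prod_mor is_ds_mor_ds_prod_mor algebra_simps)
qed (use assms in \<open>auto simp: is_ds_mor_ds_prod_mor\<close>)

text \<open>
  Puts products of identities and transpositions into the form \<open>inj_mor\<close>, where the hexagon can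
  be checked on points.
\<close>

lemma ds_prod_mor_inj_mor:
  assumes "-1 \<le> n" "-1 \<le> m" "p \<in> {0..n} \<rightarrow> {0..n'}" "q \<in> {0..m} \<rightarrow> {0..m'}"
  shows "ds_prod_mor (inj_mor n n' p) (inj_mor m m' q) = inj_mor (n + m + 1) (n' + m' + 1)
    (\<lambda>x. if x \<le> n then p x else q (x - (n + 1)) + (n' + 1))" (is "?l = ?r")
proof (rule ds_mor.equality)
  have p: "p x \<le> n'" if "0 \<le> x" "x \<le> n" for x
    using assms(3) that by auto
  have q: "0 \<le> q x" if "0 \<le> x" "x \<le> m" for x
    using assms(4) that by auto
  show "umap ?l = umap ?r"
    by (auto simp: ds_prod_mor_def ds_prod_ob_def inj_mor_def fun_eq_iff)
  have "(x, y) \<in> fib_ord ?l i \<longleftrightarrow> (x, y) \<in> fib_ord ?r i" for x y i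
    using assms(1,2) p[of x] q[of "x - (n + 1)"]
    by (cases "x \<le> n")
      (auto simp: fib_ord_ds_prod_mor mem_shifted_rel_iff inj_mor_def Id_on_iff)
  then show "fib_ord ?l = fib_ord ?r"
    by (intro ext) auto
qed simp_all

lemma ds_prod_mor_ds_id:
  assumes "-1 \<le> n" "-1 \<le> m"
  shows "ds_prod_mor (ds_id n) (ds_id m) = ds_id (n + m + 1)"
  unfolding ds_id_def using assms by (subst ds_prod_mor_inj_mor) (auto intro!: inj_mor_cong)

lemma ds_prod_mor_unit_left:
  assumes "is_ds_mor f"
  shows "ds_prod_mor (ds_id (-1)) f = f"
  using assms is_ds_mor_ge[OF assms]
  by (intro ds_mor_eqI)
    (auto simp: is_ds_mor_ds_prod_mor is_ds_mor_ds_id umap_ds_prod_mor fibre_le_ds_prod_mor)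

lemma ds_prod_mor_unit_right:
  assumes "is_ds_mor f"
  shows "ds_prod_mor f (ds_id (-1)) = f"
  using assms is_ds_mor_ge[OF assms]
  by (intro ds_mor_eqI)
    (auto simp: is_ds_mor_ds_prod_mor is_ds_mor_ds_id umap_ds_prod_mor fibre_le_ds_prod_mor)


section \<open>The transposition\<close>

abbreviation block_swap :: "int \<Rightarrow> int \<Rightarrow> int \<Rightarrow> int" where
  "block_swap n m \<equiv> \<lambda>x. if x \<le> n then x + (m + 1) else x - (n + 1)"

lemma ds_gamma_eq: "ds_gamma n m = inj_mor (n + m + 1) (n + m + 1) (block_swap n m)"
  by (simp add: ds_gamma_def ds_prod_ob_def add.commute)

lemma block_swap_props:
  assumes "-1 \<le> n" "-1 \<le> m"
  shows "block_swap n m \<in> {0..n + m + 1} \<rightarrow> {0..n + m + 1}" "inj_on (block_swap n m) {0..n + m + 1}"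
  using assms by (auto simp: inj_on_def split: if_splits)

lemma is_ds_mor_ds_gamma: "-1 \<le> n \<Longrightarrow> -1 \<le> m \<Longrightarrow> is_ds_mor (ds_gamma n m)"
  unfolding ds_gamma_eq by (intro is_ds_mor_inj_mor block_swap_props) auto

lemma src_tgt_ds_gamma [simp]:
  "src (ds_gamma n m) = n + m + 1" "tgt (ds_gamma n m) = n + m + 1"
  by (simp_all add: ds_gamma_eq)

text \<open>
  After the product, the transposition leaves fibres untouched, as it is injective; before the product,
  it relabels points. So the claim about orders is that the block swap is an
  isomorphism from the relation of \<open>f \<odot> g\<close> to that of \<open>g \<odot> f\<close>.
\<close>

lemma ds_gamma_natural:
  assumes f: "is_ds_mor f" and g: "is_ds_mor g"
  shows "ds_comp (ds_gamma (tgt f) (tgt g)) (ds_prod_mor f g) =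
    ds_comp (ds_prod_mor g f) (ds_gamma (src f) (src g))" (is "?l = ?r")
proof (rule ds_mor_eqI)
  note ge = is_ds_mor_ge[OF f] is_ds_mor_ge[OF g]
  have P: "is_ds_mor (ds_prod_mor f g)" and Q: "is_ds_mor (ds_prod_mor g f)"
    using f g by (simp_all add: is_ds_mor_ds_prod_mor)
  show "is_ds_mor ?l" "is_ds_mor ?r"
    using P Q ge by (simp_all add: is_ds_mor_ds_gamma is_ds_mor_ds_comp)
  show "src ?l = src ?r" "tgt ?l = tgt ?r"
    by simp_all
  fix x assume x: "0 \<le> x" "x \<le> src ?r"
  show "umap ?l x = umap ?r x"
    using x ge umap_ds_prod_mor_bounds[OF f g, of x] unfolding ds_gamma_eq
    by (auto simp: umap_ds_prod_mor)
  fix y assume y: "0 \<le> y" "y \<le> src ?r"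
  let ?s = "block_swap (src f) (src g)"
  have "fibre_le ?l x y \<longleftrightarrow> fibre_le (ds_prod_mor f g) x y"
    using P by (auto simp: fibre_le_ds_comp ds_gamma_eq)
  also have "\<dots> \<longleftrightarrow> fibre_le (ds_prod_mor g f) (?s x) (?s y)"
  proof (cases "x \<le> src f")
    case True
    then have "fibre_le (ds_prod_mor g f) (?s x) (?s y) \<longleftrightarrow> fibre_le f x (?s y - (src g + 1))"
      using f g x by (simp add: fibre_le_ds_prod_mor_right)
    also have "\<dots> \<longleftrightarrow> fibre_le f x y"
      using y by (cases "y \<le> src f") (simp_all add: fibre_le_def)
    finally show ?thesis
      using True f g by (simp add: fibre_le_ds_prod_mor_left)
  next
    case False
    then have "fibre_le (ds_prod_mor g f) (?s x) (?s y) \<longleftrightarrow> fibre_le g (x - (src f + 1)) (?s y)"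
      using f g x by (simp add: fibre_le_ds_prod_mor_left)
    also have "\<dots> \<longleftrightarrow> fibre_le g (x - (src f + 1)) (y - (src f + 1))"
      using y by (cases "y \<le> src f") (simp_all add: fibre_le_def)
    finally show ?thesis
      using False f g by (simp add: fibre_le_ds_prod_mor_right)
  qed
  also have "\<dots> \<longleftrightarrow> fibre_le ?r x y"
  proof -
    have "fibre_le (ds_prod_mor g f) (?s x) (?s x)"
      using Q x ge by (intro fibre_le_refl) auto
    moreover have "?s x = ?s y \<longleftrightarrow> x = y"
      using block_swap_props(2)[of "src f" "src g"] ge x y by (intro inj_on_eq_iff) auto
    moreover have "is_ds_mor (ds_gamma (src f) (src g))"
      using ge by (simp add: is_ds_mor_ds_gamma)
    ultimately show ?thesis
      using x y by (auto simp: fibre_le_ds_comp ds_gamma_eq)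
  qed
  finally show "fibre_le ?l x y \<longleftrightarrow> fibre_le ?r x y" .
qed

lemma ds_gamma_involutive:
  assumes "-1 \<le> n" "-1 \<le> m"
  shows "ds_comp (ds_gamma m n) (ds_gamma n m) = ds_id (n + m + 1)"
proof -
  have eq: "m + n + 1 = n + m + 1"
    by simp
  show ?thesis
    unfolding ds_gamma_eq ds_id_def eq ds_comp_inj_mor_inj_mor[OF block_swap_props[OF assms]]
    using assms by (intro inj_mor_cong) auto
qed

lemma ds_gamma_unit:
  assumes "-1 \<le> n"
  shows "ds_gamma n (-1) = ds_id n" "ds_gamma (-1) n = ds_id n"
  unfolding ds_gamma_eq ds_id_def by (auto intro!: inj_mor_cong)

text \<open>
  Moving the block \<open>c\<close> first past \<open>b\<close> and then past \<open>a\<close> is the same as moving it past both at once: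
  with \<open>?p\<close> the first move and \<open>?q\<close> the second, both sides send \<open>x\<close> to \<open>x + (c + 1)\<close> on the
  blocks \<open>a\<close> and \<open>b\<close>, and to \<open>x - (a + b + 2)\<close> on the block \<open>c\<close>.
\<close>

lemma ds_gamma_hexagon:
  assumes a: "-1 \<le> a" and b: "-1 \<le> b" and c: "-1 \<le> c"
  shows "ds_gamma (a + b + 1) c =
    ds_comp (ds_prod_mor (ds_gamma a c) (ds_id b)) (ds_prod_mor (ds_id a) (ds_gamma b c))"
proof -
  let ?N = "a + (b + c + 1) + 1"
  let ?p = "\<lambda>x. if x \<le> a then x else block_swap b c (x - (a + 1)) + (a + 1)"
  let ?q = "\<lambda>x. if x \<le> a + c + 1 then block_swap a c x
    else x - (a + c + 1 + 1) + (a + c + 1 + 1)"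
  have p: "ds_prod_mor (ds_id a) (ds_gamma b c) = inj_mor ?N ?N ?p"
    unfolding ds_gamma_eq ds_id_def
    using block_swap_props(1)[OF b c] a b c by (intro ds_prod_mor_inj_mor) auto
  have "ds_prod_mor (ds_gamma a c) (ds_id b) = inj_mor (a + c + 1 + b + 1) (a + c + 1 + b + 1) ?q"
    unfolding ds_gamma_eq ds_id_def
    using block_swap_props(1)[OF a c] a b c by (intro ds_prod_mor_inj_mor) auto
  moreover have "a + c + 1 + b + 1 = ?N"
    by simp
  ultimately have q: "ds_prod_mor (ds_gamma a c) (ds_id b) = inj_mor ?N ?N ?q"
    by simp
  have "?p \<in> {0..?N} \<rightarrow> {0..?N}" "inj_on ?p {0..?N}"
    using a b c by (auto simp: inj_on_def split: if_splits)
  then have "ds_comp (inj_mor ?N ?N ?q) (inj_mor ?N ?N ?p) = inj_mor ?N ?N (?q \<circ> ?p)"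
    by (rule ds_comp_inj_mor_inj_mor)
  also have "\<dots> = ds_gamma (a + b + 1) c"
    unfolding ds_gamma_eq using a b c by (intro inj_mor_cong) auto
  finally show ?thesis
    unfolding p q by simp
qed


section \<open>The permutative structure\<close>

lemma product_cat_simps:
  "Ob (product_cat C D) = Ob C \<times> Ob D"
  "Idn (product_cat C D) (a, b) = (Idn C a, Idn D b)"
  "Comp (product_cat C D) (f', g') (f, g) = (Comp C f' f, Comp D g' g)"
  "Hom (product_cat C D) (a, b) (a', b') = Hom C a a' \<times> Hom D b b'"
  by (auto simp: Hom_def product_cat_def)

lemma category_product_cat:
  assumes "category C" "category D"
  shows "category (product_cat C D)"
proof -
  interpret C: category C by fact
  interpret D: category D by fact
  show ?thesis
    by (rule category.intro)
      (auto simp: product_cat_simps C.id_in_Hom C.comp_in_Hom C.comp_id_right C.comp_id_left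
        C.comp_assoc D.id_in_Hom D.comp_in_Hom D.comp_id_right D.comp_id_left D.comp_assoc,
       auto simp: product_cat_def C.dom_in_Ob C.cod_in_Ob D.dom_in_Ob D.cod_in_Ob)
qed

text \<open>
  Reduces functoriality on a product category to conditions on pairs; it serves both for
  \<open>\<odot>\<close> and for \<open>\<odot>\<close> with its arguments exchanged, the source and the target of the symmetry.
\<close>

lemma bifunctorI:
  assumes "category C" "category D" "category E"
    and ob: "\<And>a b. \<lbrakk>a \<in> Ob C; b \<in> Ob D\<rbrakk> \<Longrightarrow> Fo a b \<in> Ob E"
    and hom: "\<And>f g a b a' b'. \<lbrakk>f \<in> Hom C a a'; g \<in> Hom D b b'\<rbrakk> \<Longrightarrow>
      Fm f g \<in> Hom E (Fo a b) (Fo a' b')"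
    and idn: "\<And>a b. \<lbrakk>a \<in> Ob C; b \<in> Ob D\<rbrakk> \<Longrightarrow> Fm (Idn C a) (Idn D b) = Idn E (Fo a b)"
    and comp: "\<And>f g f' g' a b a' b' a'' b''.
      \<lbrakk>f \<in> Hom C a a'; f' \<in> Hom C a' a''; g \<in> Hom D b b'; g' \<in> Hom D b' b''\<rbrakk> \<Longrightarrow>
      Fm (Comp C f' f) (Comp D g' g) = Comp E (Fm f' g') (Fm f g)"
  shows "covariant_functor (product_cat C D) E (\<lambda>(a, b). Fo a b) (\<lambda>(f, g). Fm f g)"
  using assms(1-3)
  by (intro covariant_functor.intro category_product_cat covariant_functor_axioms.intro)
    (auto simp: product_cat_simps ob hom idn comp)

lemma Ob_DeltaS_plus [simp]: "n \<in> Ob DeltaS_plus \<longleftrightarrow> -1 \<le> n"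
  and Mor_DeltaS_plus [simp]: "f \<in> Mor DeltaS_plus \<longleftrightarrow> is_ds_mor f"
  and Idn_DeltaS_plus [simp]: "Idn DeltaS_plus = ds_id"
  and Comp_DeltaS_plus [simp]: "Comp DeltaS_plus = ds_comp"
  and Hom_DeltaS_plus [simp]: "f \<in> Hom DeltaS_plus n m \<longleftrightarrow> is_ds_mor f \<and> src f = n \<and> tgt f = m"
  by (simp_all add: DeltaS_plus_def Hom_def)

lemma product_functor:
  "covariant_functor (product_cat DeltaS_plus DeltaS_plus) DeltaS_plus
    (\<lambda>(a, b). ds_prod_ob a b) (\<lambda>(f, g). ds_prod_mor f g)"
  by (rule bifunctorI)
    (auto simp: category_DeltaS_plus ds_prod_ob_def is_ds_mor_ds_prod_mor
      ds_prod_mor_ds_id ds_prod_mor_comp)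

lemma swapped_product_functor:
  "covariant_functor (product_cat DeltaS_plus DeltaS_plus) DeltaS_plus
    (\<lambda>(a, b). ds_prod_ob b a) (\<lambda>(f, g). ds_prod_mor g f)"
  by (rule bifunctorI)
    (auto simp: category_DeltaS_plus ds_prod_ob_def is_ds_mor_ds_prod_mor
      ds_prod_mor_ds_id ds_prod_mor_comp)

lemma symmetry_natural_transformation:
  "natural_transformation (product_cat DeltaS_plus DeltaS_plus) DeltaS_plus
    (\<lambda>(a, b). ds_prod_ob a b) (\<lambda>(f, g). ds_prod_mor f g)
    (\<lambda>(a, b). ds_prod_ob b a) (\<lambda>(f, g). ds_prod_mor g f)
    (\<lambda>(a, b). ds_gamma a b)"
proof (intro natural_transformation.intro product_functor swapped_product_functor
    natural_transformation_axioms.intro, goal_cases)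
  case (2 f a b)
  then show ?case
    by (cases f, cases a, cases b) (auto simp: product_cat_simps ds_gamma_natural)
qed (auto simp: product_cat_simps ds_prod_ob_def is_ds_mor_ds_gamma)

theorem proposition9:
  shows "permutative_category DeltaS_plus ds_prod_ob ds_prod_mor (-1) ds_gamma"
  by (intro permutative_category.intro permutative_category_axioms.intro category_DeltaS_plus
      product_functor symmetry_natural_transformation)
    (simp_all add: ds_prod_ob_def ds_prod_mor_assoc ds_prod_mor_unit_left ds_prod_mor_unit_right
      ds_gamma_involutive ds_gamma_unit ds_gamma_hexagon)

end
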